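(* Let $G$ be a finite perfect group. If a group $H$ is a Schur cover (in the sense of group theory) of $G$, then $H$, regarded as a trivial skew brace, is a skew brace Schur cover of $G$, regarded as a trivial skew brace.
   Context: A skew brace is a triple $(A,+,\circ)$ where $(A,+)$ and $(A,\circ)$ are (not necessarily abelian) groups with $a\circ(b+c)=a\circ b-a+a\circ c$ for all $a,b,c\in A$. Both groups have the same neutral element $0$. A group $G$ is regarded as a trivial skew brace via $x+y=xy$ and $x\circ y=xy$. A group $H$ is a Schur cover of a finite group $G$ if there is a central extension $1\to K\to H\to G\to1$ with $K\subseteq[H,H]$ and $K\simeq M(G)$, where $M(G)=H^2(G,\mathbb{C}^\times)$ (trivial action). The annihilator of a skew brace $A$ is $\mathrm{Ann}(A)=\{a\in A: -a+a\circ b=b\ \forall b\in A\}\cap Z(A,+)\cap Z(A,\circ)$. The commutator $A'$ is the additive subgroup of $A$ generated by all $a+b-a-b$ and all $-a+a\circ b-b$, $a,b\in A$. An annihilator extension of $Q$ by an abelian group $K$ is a short exact sequence of skew braces $0\to K\to E\to Q\to0$ with the image of $K$ contained in $\mathrm{Ann}(E)$ ($K$ a trivial skew brace, identified with its image). A (skew brace) Schur cover of a finite skew brace $Q$ is a skew brace $E$ for which there exists an annihilator extension $0\to K\to E\to Q\to0$ with $K\subseteq E'$ and $K\simeq M_b(Q)$. For a skew brace $Q$ and a (multiplicative) abelian group $K$, a factor set is a pair $(\alpha,\mu)$ of maps $Q\times Q\to K$ such that for all $x,y,z\in Q$: $\alpha(0,y)=\alpha(x,0)=1$, $\mu(0,y)=\mu(x,0)=1$,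 $\alpha(y,z)\alpha(x+y,z)^{-1}\alpha(x,y+z)\alpha(x,y)^{-1}=1$, $\mu(y,z)\mu(x\circ y,z)^{-1}\mu(x,y\circ z)\mu(x,y)^{-1}=1$, and $\alpha(y,z)\mu(x,y+z)\alpha(-x,x)=\mu(x,z)\alpha(x\circ y,-x)\alpha(x\circ y-x,x\circ z)\mu(x,y)$. Factor sets form a group $Z^2_b(Q,K)$ under pointwise multiplication. For $h:Q\to K$ put $\partial_+h(x,y)=h(y)h(x+y)^{-1}h(x)$ and $\partial_\circ h(x,y)=h(y)h(x\circ y)^{-1}h(x)$. Let $B^2_b(Q,K)=\{(\partial_+h,\partial_\circ h): h:Q\to K,\ h(0)=1\}$ and $H^2_b(Q,K)=Z^2_b(Q,K)/B^2_b(Q,K)$. The Schur multiplier of a finite skew brace $Q$ is $M_b(Q)=H^2_b(Q,\mathbb{C}^\times)$. *)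

theory Defs
  imports Complex_Main "HOL-Algebra.Algebra"
begin

section \<open>Skew braces\<close>

text \<open>
  A skew brace is carried by the record type of rings: \<open>\<oplus>\<close> is the (possibly non-abelian)
  additive group operation, so that \<open>\<ominus>\<close> is its inverse, and \<open>\<otimes>\<close> is the circle operation.
  That \<open>\<zero>\<close> and \<open>\<one>\<close> coincide is a consequence of the axioms.
\<close>

locale skew_brace =
  fixes A :: "('a, 'm) ring_scheme" (structure)
  assumes add_group: "group (add_monoid A)"
    and circ_group: "group A"
    and brace: "\<lbrakk>a \<in> carrier A; b \<in> carrier A; c \<in> carrier A\<rbrakk>
      \<Longrightarrow> a \<otimes> (b \<oplus> c) = a \<otimes> b \<ominus> a \<oplus> a \<otimes> c"

lemma (in skew_brace) zero_eq_one: "\<zero> = \<one>"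
proof -
  interpret P: group "add_monoid A" by (rule add_group)
  interpret M: group A by (rule circ_group)
  have o: "\<one> \<in> carrier A" and z: "\<zero> \<in> carrier A"
    using P.one_closed by simp_all
  have "\<zero> \<oplus> \<zero> = \<zero>" using P.l_one[of \<zero>] z by simp
  with brace[OF o z z] have "\<zero> = \<zero> \<ominus> \<one> \<oplus> \<zero>" by (simp add: z)
  moreover have "\<ominus> \<one> \<in> carrier A" using P.inv_closed o by (simp add: a_inv_def)
  ultimately have "\<ominus> \<one> = \<zero>"
    using P.l_one P.r_one by (simp add: a_minus_def)
  then show ?thesis using P.inv_eq_1_iff[of \<one>] o by (simp add: a_inv_def)
qed

definition trivial_skew_brace :: "('a, 'm) monoid_scheme \<Rightarrow> 'a ring" where
  "trivial_skew_brace G =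
    \<lparr>carrier = carrier G, monoid.mult = monoid.mult G, one = one G,
     ring.zero = one G, ring.add = monoid.mult G\<rparr>"

lemma skew_brace_trivial:
  fixes G (structure)
  assumes "group G"
  shows "skew_brace (trivial_skew_brace G)"
proof -
  interpret group G by fact
  have m: "group (add_monoid (trivial_skew_brace G))" "group (trivial_skew_brace G)"
    by (rule groupI; auto simp: trivial_skew_brace_def m_assoc intro: l_inv_ex)+
  have i: "\<ominus>\<^bsub>trivial_skew_brace G\<^esub> a = inv a" for a
    by (simp add: a_inv_def m_inv_def trivial_skew_brace_def)
  show ?thesis
  proof (rule skew_brace.intro[OF m])
    fix a b c
    assume "a \<in> carrier (trivial_skew_brace G)" "b \<in> carrier (trivial_skew_brace G)"
      "c \<in> carrier (trivial_skew_brace G)"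
    then have abc: "a \<in> carrier G" "b \<in> carrier G" "c \<in> carrier G"
      by (simp_all add: trivial_skew_brace_def)
    then have "inv a \<otimes> (a \<otimes> c) = c" by (simp flip: m_assoc)
    with abc have "a \<otimes> (b \<otimes> c) = a \<otimes> b \<otimes> inv a \<otimes> (a \<otimes> c)"
      by (simp add: m_assoc)
    then show "a \<otimes>\<^bsub>trivial_skew_brace G\<^esub> (b \<oplus>\<^bsub>trivial_skew_brace G\<^esub> c)
        = a \<otimes>\<^bsub>trivial_skew_brace G\<^esub> b \<ominus>\<^bsub>trivial_skew_brace G\<^esub> a
          \<oplus>\<^bsub>trivial_skew_brace G\<^esub> a \<otimes>\<^bsub>trivial_skew_brace G\<^esub> c"
      by (simp add: a_minus_def i) (simp add: trivial_skew_brace_def)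
  qed
qed

definition skew_brace_hom :: "('a, 'm) ring_scheme \<Rightarrow> ('b, 'n) ring_scheme \<Rightarrow> ('a \<Rightarrow> 'b) set" where
  "skew_brace_hom A B = hom (add_monoid A) (add_monoid B) \<inter> hom A B"

definition group_center :: "('a, 'm) monoid_scheme \<Rightarrow> 'a set" where
  "group_center G = {z \<in> carrier G. \<forall>x\<in>carrier G. z \<otimes>\<^bsub>G\<^esub> x = x \<otimes>\<^bsub>G\<^esub> z}"

definition annihilator :: "('a, 'm) ring_scheme \<Rightarrow> 'a set" where
  "annihilator A =
    {a \<in> carrier A. \<forall>b\<in>carrier A. \<ominus>\<^bsub>A\<^esub> a \<oplus>\<^bsub>A\<^esub> a \<otimes>\<^bsub>A\<^esub> b = b}
    \<inter> group_center (add_monoid A) \<inter> group_center A"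

definition brace_commutator :: "('a, 'm) ring_scheme \<Rightarrow> 'a set" where
  "brace_commutator A = generate (add_monoid A)
    ({a \<oplus>\<^bsub>A\<^esub> b \<ominus>\<^bsub>A\<^esub> a \<ominus>\<^bsub>A\<^esub> b | a b. a \<in> carrier A \<and> b \<in> carrier A}
     \<union> {\<ominus>\<^bsub>A\<^esub> a \<oplus>\<^bsub>A\<^esub> a \<otimes>\<^bsub>A\<^esub> b \<ominus>\<^bsub>A\<^esub> b | a b. a \<in> carrier A \<and> b \<in> carrier A})"


section \<open>Second cohomology groups and Schur multipliers\<close>

definition units_complex :: "complex monoid" where
  "units_complex = \<lparr>carrier = - {0}, monoid.mult = (*), one = 1\<rparr>"

text \<open>
  All maps \<open>Q \<times> Q \<rightarrow> K\<close>, under pointwise multiplication.  Maps are extensional (\<^const>\<open>undefined\<close>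
  outside \<open>Q \<times> Q\<close>), so that equality of maps is equality on the carrier.
\<close>

definition cochains2 :: "'a set \<Rightarrow> ('k, 'n) monoid_scheme \<Rightarrow> ('a \<times> 'a \<Rightarrow> 'k) monoid" where
  "cochains2 Q K = product_group (Q \<times> Q) (\<lambda>_. K)"

definition coboundary :: "('a, 'm) monoid_scheme \<Rightarrow> ('k, 'n) monoid_scheme \<Rightarrow> ('a \<Rightarrow> 'k) \<Rightarrow> 'a \<times> 'a \<Rightarrow> 'k" where
  "coboundary G K h = (\<lambda>(x, y) \<in> carrier G \<times> carrier G.
     h y \<otimes>\<^bsub>K\<^esub> inv\<^bsub>K\<^esub> h (x \<otimes>\<^bsub>G\<^esub> y) \<otimes>\<^bsub>K\<^esub> h x)"

definition cocycle_condition :: "('a, 'm) monoid_scheme \<Rightarrow> ('k, 'n) monoid_scheme \<Rightarrow> ('a \<times> 'a \<Rightarrow> 'k) \<Rightarrow> bool" where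
  "cocycle_condition G K f \<longleftrightarrow>
    (\<forall>x\<in>carrier G. \<forall>y\<in>carrier G. \<forall>z\<in>carrier G.
       f (y, z) \<otimes>\<^bsub>K\<^esub> inv\<^bsub>K\<^esub> f (x \<otimes>\<^bsub>G\<^esub> y, z) \<otimes>\<^bsub>K\<^esub> f (x, y \<otimes>\<^bsub>G\<^esub> z)
         \<otimes>\<^bsub>K\<^esub> inv\<^bsub>K\<^esub> f (x, y) = \<one>\<^bsub>K\<^esub>)"

text \<open>
  Ordinary group cohomology with trivial action, by inhomogeneous cochains that are not required to
  be normalized.
\<close>

definition group_Z2 :: "('a, 'm) monoid_scheme \<Rightarrow> ('k, 'n) monoid_scheme \<Rightarrow> ('a \<times> 'a \<Rightarrow> 'k) set" where
  "group_Z2 G K = {f \<in> carrier (cochains2 (carrier G) K). cocycle_condition G K f}"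

definition group_B2 :: "('a, 'm) monoid_scheme \<Rightarrow> ('k, 'n) monoid_scheme \<Rightarrow> ('a \<times> 'a \<Rightarrow> 'k) set" where
  "group_B2 G K = coboundary G K ` (carrier G \<rightarrow> carrier K)"

definition group_H2 :: "('a, 'm) monoid_scheme \<Rightarrow> ('k, 'n) monoid_scheme \<Rightarrow> ('a \<times> 'a \<Rightarrow> 'k) set monoid" where
  "group_H2 G K = (cochains2 (carrier G) K) \<lparr>carrier := group_Z2 G K\<rparr> Mod group_B2 G K"

definition schur_multiplier :: "('a, 'm) monoid_scheme \<Rightarrow> ('a \<times> 'a \<Rightarrow> complex) set monoid" where
  "schur_multiplier G = group_H2 G units_complex"

definition factor_set ::
  "('a, 'm) ring_scheme \<Rightarrow> ('k, 'n) monoid_scheme \<Rightarrow> ('a \<times> 'a \<Rightarrow> 'k) \<Rightarrow> ('a \<times> 'a \<Rightarrow> 'k) \<Rightarrow> bool" where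
  "factor_set Q K \<alpha> \<mu> \<longleftrightarrow>
    \<alpha> \<in> carrier (cochains2 (carrier Q) K) \<and> \<mu> \<in> carrier (cochains2 (carrier Q) K) \<and>
    (\<forall>x\<in>carrier Q. \<alpha> (\<zero>\<^bsub>Q\<^esub>, x) = \<one>\<^bsub>K\<^esub> \<and> \<alpha> (x, \<zero>\<^bsub>Q\<^esub>) = \<one>\<^bsub>K\<^esub>) \<and>
    (\<forall>x\<in>carrier Q. \<mu> (\<zero>\<^bsub>Q\<^esub>, x) = \<one>\<^bsub>K\<^esub> \<and> \<mu> (x, \<zero>\<^bsub>Q\<^esub>) = \<one>\<^bsub>K\<^esub>) \<and>
    cocycle_condition (add_monoid Q) K \<alpha> \<and>
    cocycle_condition Q K \<mu> \<and>
    (\<forall>x\<in>carrier Q. \<forall>y\<in>carrier Q. \<forall>z\<in>carrier Q.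
       \<alpha> (y, z) \<otimes>\<^bsub>K\<^esub> \<mu> (x, y \<oplus>\<^bsub>Q\<^esub> z) \<otimes>\<^bsub>K\<^esub> \<alpha> (\<ominus>\<^bsub>Q\<^esub> x, x)
       = \<mu> (x, z) \<otimes>\<^bsub>K\<^esub> \<alpha> (x \<otimes>\<^bsub>Q\<^esub> y, \<ominus>\<^bsub>Q\<^esub> x)
           \<otimes>\<^bsub>K\<^esub> \<alpha> (x \<otimes>\<^bsub>Q\<^esub> y \<ominus>\<^bsub>Q\<^esub> x, x \<otimes>\<^bsub>Q\<^esub> z) \<otimes>\<^bsub>K\<^esub> \<mu> (x, y))"

definition brace_Z2 ::
  "('a, 'm) ring_scheme \<Rightarrow> ('k, 'n) monoid_scheme \<Rightarrow> (('a \<times> 'a \<Rightarrow> 'k) \<times> ('a \<times> 'a \<Rightarrow> 'k)) set" where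
  "brace_Z2 Q K = {(\<alpha>, \<mu>). factor_set Q K \<alpha> \<mu>}"

definition brace_B2 ::
  "('a, 'm) ring_scheme \<Rightarrow> ('k, 'n) monoid_scheme \<Rightarrow> (('a \<times> 'a \<Rightarrow> 'k) \<times> ('a \<times> 'a \<Rightarrow> 'k)) set" where
  "brace_B2 Q K = {(coboundary (add_monoid Q) K h, coboundary Q K h) | h.
     h \<in> carrier Q \<rightarrow> carrier K \<and> h \<zero>\<^bsub>Q\<^esub> = \<one>\<^bsub>K\<^esub>}"

definition brace_H2 ::
  "('a, 'm) ring_scheme \<Rightarrow> ('k, 'n) monoid_scheme \<Rightarrow> (('a \<times> 'a \<Rightarrow> 'k) \<times> ('a \<times> 'a \<Rightarrow> 'k)) set monoid" where
  "brace_H2 Q K =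
    (cochains2 (carrier Q) K \<times>\<times> cochains2 (carrier Q) K) \<lparr>carrier := brace_Z2 Q K\<rparr> Mod brace_B2 Q K"

definition brace_schur_multiplier ::
  "('a, 'm) ring_scheme \<Rightarrow> (('a \<times> 'a \<Rightarrow> complex) \<times> ('a \<times> 'a \<Rightarrow> complex)) set monoid" where
  "brace_schur_multiplier Q = brace_H2 Q units_complex"


section \<open>Schur covers\<close>

definition central_extension ::
  "('k, 'l) monoid_scheme \<Rightarrow> ('k \<Rightarrow> 'h) \<Rightarrow> ('h, 'm) monoid_scheme \<Rightarrow> ('h \<Rightarrow> 'g) \<Rightarrow> ('g, 'n) monoid_scheme \<Rightarrow> bool" where
  "central_extension K i H p G \<longleftrightarrow>
    group K \<and> group H \<and> group G \<and>
    i \<in> mon K H \<and> p \<in> epi H G \<and> i ` carrier K = kernel H G p \<and>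
    i ` carrier K \<subseteq> group_center H"

text \<open>
  In both notions of Schur cover the kernel \<open>K\<close> ranges over groups on the type of the covering
  object.  This loses nothing, since \<open>K\<close> may be replaced by its image.
\<close>

definition group_schur_cover :: "('h, 'm) monoid_scheme \<Rightarrow> ('g, 'n) monoid_scheme \<Rightarrow> bool" where
  "group_schur_cover H G \<longleftrightarrow>
    group G \<and> finite (carrier G) \<and>
    (\<exists>(K :: 'h monoid) i p. central_extension K i H p G \<and>
       i ` carrier K \<subseteq> derived H (carrier H) \<and> K \<cong> schur_multiplier G)"

definition annihilator_extension ::
  "('k, 'l) monoid_scheme \<Rightarrow> ('k \<Rightarrow> 'e) \<Rightarrow> ('e, 'm) ring_scheme \<Rightarrow> ('e \<Rightarrow> 'q) \<Rightarrow> ('q, 'n) ring_scheme \<Rightarrow> bool" where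
  "annihilator_extension K i E p Q \<longleftrightarrow>
    comm_group K \<and> skew_brace E \<and> skew_brace Q \<and>
    i \<in> skew_brace_hom (trivial_skew_brace K) E \<and> inj_on i (carrier K) \<and>
    p \<in> skew_brace_hom E Q \<and> p ` carrier E = carrier Q \<and>
    i ` carrier K = kernel (add_monoid E) (add_monoid Q) p \<and>
    i ` carrier K \<subseteq> annihilator E"

definition brace_schur_cover :: "('e, 'm) ring_scheme \<Rightarrow> ('q, 'n) ring_scheme \<Rightarrow> bool" where
  "brace_schur_cover E Q \<longleftrightarrow>
    skew_brace Q \<and> finite (carrier Q) \<and>
    (\<exists>(K :: 'e monoid) i p. annihilator_extension K i E p Q \<and>
       i ` carrier K \<subseteq> brace_commutator E \<and> K \<cong> brace_schur_multiplier Q)"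

definition perfect_group :: "('a, 'm) monoid_scheme \<Rightarrow> bool" where
  "perfect_group G \<longleftrightarrow> group G \<and> derived G (carrier G) = carrier G"

end

theory Submission
  imports Defs
begin

text \<open>
  Let \<open>K\<close> be an abelian group and \<open>(\<alpha>, \<mu>)\<close> a factor set on the trivial skew brace of \<open>G\<close>.  A group
  2-cocycle always satisfies the compatibility condition of factor sets when it is used for both
  operations, so the compatibility condition for \<open>(\<alpha>, \<mu>)\<close> divided by the one for \<open>(\<alpha>, \<alpha>)\<close> says that
  \<open>\<beta> = \<mu> / \<alpha>\<close> is multiplicative in its second argument.  As \<open>\<beta>\<close> is also a 2-cocycle, it is
  multiplicative in its first argument, hence trivial if \<open>G\<close> is perfect.  Thus factor sets
  are the pairs \<open>(\<alpha>, \<alpha>)\<close> with \<open>\<alpha>\<close> a normalized 2-cocycle, and \<open>M\<^sub>b(G) \<cong> M(G)\<close> because every cohomology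
  class has a normalized representative.  The extension defining the Schur cover \<open>H\<close> then serves for
  the trivial skew braces as well.
\<close>

section \<open>Trivial skew braces\<close>

lemma trivial_skew_brace_simps [simp]:
  "carrier (trivial_skew_brace G) = carrier G"
  "monoid.mult (trivial_skew_brace G) = monoid.mult G"
  "one (trivial_skew_brace G) = one G"
  "ring.zero (trivial_skew_brace G) = one G"
  "ring.add (trivial_skew_brace G) = monoid.mult G"
  by (simp_all add: trivial_skew_brace_def)

lemma a_inv_trivial_skew_brace [simp]: "\<ominus>\<^bsub>trivial_skew_brace G\<^esub> a = inv\<^bsub>G\<^esub> a"
  by (simp add: a_inv_def m_inv_def)

lemma skew_brace_hom_trivial [simp]:
  "skew_brace_hom (trivial_skew_brace G) (trivial_skew_brace H) = hom G H"
  by (simp add: skew_brace_hom_def hom_def)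

text \<open>Here -a + a \<circ> b is the product of a^-1 and ab, which is b, so only centrality is
  left of the definition.\<close>

lemma (in group) annihilator_trivial [simp]:
  "annihilator (trivial_skew_brace G) = group_center G"
  by (auto simp: annihilator_def group_center_def simp flip: m_assoc)

text \<open>The additive commutators among the generators of the skew brace commutator are exactly
  the group commutators. This turns the condition that the kernel lies in [H,H] into the one for
  skew braces.\<close>

lemma (in group) derived_subset_brace_commutator:
  "derived G (carrier G) \<subseteq> brace_commutator (trivial_skew_brace G)"
proof -
  let ?A = "add_monoid (trivial_skew_brace G)"
  have inv_A: "inv\<^bsub>?A\<^esub> a = inv a" for a by (simp add: m_inv_def)
  interpret A: group ?A
    by (rule skew_brace.add_group[OF skew_brace_trivial[OF is_group]])
  \<comment> \<open>\<open>G\<close> and \<open>?A\<close> are different records, so generated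
    subgroups do not carry over by rewriting. The induction moves them across, since multiplication,
    unit and inverse agree.\<close>
  have "x \<in> generate ?A S" if "x \<in> generate G S" for x S
    using that
  proof induction
    case one
    show ?case using generate.one[of ?A S] by simp
  next
    case (incl h)
    then show ?case by (rule generate.incl)
  next
    case (inv h)
    then show ?case using generate.inv[of h S ?A] by (simp only: inv_A)
  next
    case (eng h1 h2)
    then show ?case using generate.eng[of h1 ?A S h2] by simp
  qed
  then have "derived G (carrier G) \<subseteq> generate ?A (derived_set G (carrier G))"
    unfolding derived_def by blast
  also have "\<dots> \<subseteq> brace_commutator (trivial_skew_brace G)"
    unfolding brace_commutator_def by (rule A.mono_generate) (auto simp: a_minus_def)
  finally show ?thesis .
qed

text \<open>For trivial skew braces the homomorphisms and kernels are those of the groups, and the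
  annihilator is the center. The one thing left to prove is that \<open>K\<close> is
  abelian.\<close>

lemma (in group) central_extension_trivial_skew_brace:
  assumes "central_extension K i G p Q"
  shows "annihilator_extension K i (trivial_skew_brace G) p (trivial_skew_brace Q)"
proof -
  have K: "group K" and Q: "group Q" and i: "i \<in> mon K G" and p: "p \<in> epi G Q"
    and ker: "i ` carrier K = kernel G Q p" and c: "i ` carrier K \<subseteq> group_center G"
    using assms by (auto simp: central_extension_def)
  interpret K: group K by (rule K)
  have i_hom: "i \<in> hom K G" and i_inj: "inj_on i (carrier K)"
    using i by (simp_all add: mon_def)
  \<comment> \<open>\<open>K\<close> embeds into the center of \<open>G\<close> through the
    injective map \<open>i\<close>, and commutativity is pulled back along \<open>i\<close>.\<close>
  have "comm_group K"
  proof (rule K.group_comm_groupI)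
    fix x y
    assume xy: "x \<in> carrier K" "y \<in> carrier K"
    then have "i x \<in> group_center G" "i y \<in> carrier G"
      using c hom_in_carrier[OF i_hom] by auto
    then have "i x \<otimes> i y = i y \<otimes> i x" by (simp add: group_center_def)
    with xy have "i (x \<otimes>\<^bsub>K\<^esub> y) = i (y \<otimes>\<^bsub>K\<^esub> x)"
      by (simp only: hom_mult[OF i_hom])
    with xy show "x \<otimes>\<^bsub>K\<^esub> y = y \<otimes>\<^bsub>K\<^esub> x"
      using inj_onD[OF i_inj] by simp
  qed
  then show ?thesis
    using i_hom i_inj p ker c skew_brace_trivial[OF is_group] skew_brace_trivial[OF Q]
    by (simp add: annihilator_extension_def epi_def kernel_def)
qed


section \<open>Cohomology of perfect groups\<close>

text \<open>The kernel of a homomorphism to an abelian group contains all commutators, hence the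
  derived subgroup, which is all of \<open>G\<close>.\<close>

lemma perfect_hom_trivial:
  assumes G: "perfect_group G" and K: "comm_group K" and h: "h \<in> hom G K" and x: "x \<in> carrier G"
  shows "h x = \<one>\<^bsub>K\<^esub>"
proof -
  interpret K: comm_group K by (rule K)
  interpret G: group G using G by (simp add: perfect_group_def)
  interpret h: group_hom G K h
    by (simp add: group_hom_def group_hom_axioms_def h G.is_group K.is_group)
  have "derived_set G (carrier G) \<subseteq> kernel G K h"
  proof -
    have "a \<otimes>\<^bsub>K\<^esub> b \<otimes>\<^bsub>K\<^esub> inv\<^bsub>K\<^esub> a \<otimes>\<^bsub>K\<^esub> inv\<^bsub>K\<^esub> b = \<one>\<^bsub>K\<^esub>" if "a \<in> carrier K" "b \<in> carrier K" for a b
      unfolding K.m_comm[OF that] using that by (simp add: K.m_assoc)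
    then show ?thesis by (auto simp: kernel_def)
  qed
  from G.generate_subgroup_incl[OF this h.subgroup_kernel]
  have "derived G (carrier G) \<subseteq> kernel G K h"
    by (simp add: derived_def)
  with G x show ?thesis by (auto simp: perfect_group_def kernel_def)
qed

lemma comm_group_units_complex: "comm_group units_complex"
  by (rule comm_groupI) (auto simp: units_complex_def intro!: bexI[of _ "inverse _"])

section \<open>Cochains, 2-cocycles and 2-coboundaries with values in an abelian group\<close>

locale cohomology = G: group G + K: comm_group K
  for G (structure) and K (structure)
begin

abbreviation C2 where "C2 \<equiv> cochains2 (carrier G) K"
abbreviation Z2 where "Z2 \<equiv> group_Z2 G K"
abbreviation B2 where "B2 \<equiv> group_B2 G K"

lemma comm_group_C2: "comm_group C2"
  unfolding cochains2_def
  by (rule group.group_comm_groupI) (auto simp: PiE_iff K.m_comm intro!: restrict_ext)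

sublocale C2: comm_group C2 by (rule comm_group_C2)

lemma carrier_C2: "carrier C2 = (carrier G \<times> carrier G) \<rightarrow>\<^sub>E carrier K"
  by (simp add: cochains2_def)

lemma C2_closed:
  "\<lbrakk>f \<in> carrier C2; x \<in> carrier G; y \<in> carrier G\<rbrakk> \<Longrightarrow> f (x, y) \<in> carrier K"
  by (auto simp: carrier_C2)

lemma C2_eqI:
  assumes "f \<in> carrier C2" "g \<in> carrier C2"
    and "\<And>x y. \<lbrakk>x \<in> carrier G; y \<in> carrier G\<rbrakk> \<Longrightarrow> f (x, y) = g (x, y)"
  shows "f = g"
  using assms unfolding carrier_C2 by (intro PiE_ext) auto

lemma mult_C2:
  "\<lbrakk>x \<in> carrier G; y \<in> carrier G\<rbrakk> \<Longrightarrow> (f \<otimes>\<^bsub>C2\<^esub> g) (x, y) = f (x, y) \<otimes>\<^bsub>K\<^esub> g (x, y)"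
  by (simp add: cochains2_def)

lemma one_C2: "\<lbrakk>x \<in> carrier G; y \<in> carrier G\<rbrakk> \<Longrightarrow> \<one>\<^bsub>C2\<^esub> (x, y) = \<one>\<^bsub>K\<^esub>"
  by (simp add: cochains2_def)

lemma inv_C2:
  assumes "f \<in> carrier C2" "x \<in> carrier G" "y \<in> carrier G"
  shows "(inv\<^bsub>C2\<^esub> f) (x, y) = inv\<^bsub>K\<^esub> f (x, y)"
proof -
  have "inv\<^bsub>C2\<^esub> f = (\<lambda>i\<in>carrier G \<times> carrier G. inv\<^bsub>K\<^esub> f i)"
    unfolding cochains2_def
    by (rule inv_product_group) (use assms in \<open>auto simp: carrier_C2\<close>)
  with assms show ?thesis by simp
qed

text \<open>Moving the inverted factors to the other side gives an identity without inverses, which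
  normalization by associativity and commutativity can handle.\<close>

lemma cocycle_condition_iff:
  assumes "f \<in> carrier C2"
  shows "cocycle_condition G K f \<longleftrightarrow>
    (\<forall>x\<in>carrier G. \<forall>y\<in>carrier G. \<forall>z\<in>carrier G.
      f (y, z) \<otimes>\<^bsub>K\<^esub> f (x, y \<otimes> z) = f (x \<otimes> y, z) \<otimes>\<^bsub>K\<^esub> f (x, y))"
proof -
  have "a \<otimes>\<^bsub>K\<^esub> inv\<^bsub>K\<^esub> b \<otimes>\<^bsub>K\<^esub> c \<otimes>\<^bsub>K\<^esub> inv\<^bsub>K\<^esub> d = \<one>\<^bsub>K\<^esub> \<longleftrightarrow> a \<otimes>\<^bsub>K\<^esub> c = b \<otimes>\<^bsub>K\<^esub> d"
    if "a \<in> carrier K" "b \<in> carrier K" "c \<in> carrier K" "d \<in> carrier K" for a b c d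
  proof -
    have "a \<otimes>\<^bsub>K\<^esub> inv\<^bsub>K\<^esub> b \<otimes>\<^bsub>K\<^esub> c \<otimes>\<^bsub>K\<^esub> inv\<^bsub>K\<^esub> d = (a \<otimes>\<^bsub>K\<^esub> c) \<otimes>\<^bsub>K\<^esub> inv\<^bsub>K\<^esub> (b \<otimes>\<^bsub>K\<^esub> d)"
      using that by (simp add: K.inv_mult K.m_ac)
    with that show ?thesis
      by (metis K.inv_closed K.inv_equality K.inv_inv K.m_closed K.r_inv)
  qed
  with assms show ?thesis
    by (simp add: cocycle_condition_def C2_closed)
qed

lemma Z2_iff:
  "f \<in> Z2 \<longleftrightarrow> f \<in> carrier C2 \<and>
    (\<forall>x\<in>carrier G. \<forall>y\<in>carrier G. \<forall>z\<in>carrier G.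
      f (y, z) \<otimes>\<^bsub>K\<^esub> f (x, y \<otimes> z) = f (x \<otimes> y, z) \<otimes>\<^bsub>K\<^esub> f (x, y))"
  using cocycle_condition_iff by (auto simp: group_Z2_def)

lemma Z2_carrier: "f \<in> Z2 \<Longrightarrow> f \<in> carrier C2"
  by (simp add: Z2_iff)

lemma Z2_cocycle:
  "\<lbrakk>f \<in> Z2; x \<in> carrier G; y \<in> carrier G; z \<in> carrier G\<rbrakk>
    \<Longrightarrow> f (y, z) \<otimes>\<^bsub>K\<^esub> f (x, y \<otimes> z) = f (x \<otimes> y, z) \<otimes>\<^bsub>K\<^esub> f (x, y)"
  by (simp add: Z2_iff)

lemma subgroup_Z2: "subgroup Z2 C2"
proof (rule C2.subgroupI)
  show "Z2 \<subseteq> carrier C2" by (auto simp: Z2_carrier)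
  have "\<one>\<^bsub>C2\<^esub> \<in> Z2" by (simp add: Z2_iff one_C2)
  then show "Z2 \<noteq> {}" by blast
  fix f assume f: "f \<in> Z2"
  have fC: "f \<in> carrier C2" using f by (rule Z2_carrier)
  have "inv\<^bsub>K\<^esub> f (y, z) \<otimes>\<^bsub>K\<^esub> inv\<^bsub>K\<^esub> f (x, y \<otimes> z) = inv\<^bsub>K\<^esub> f (x \<otimes> y, z) \<otimes>\<^bsub>K\<^esub> inv\<^bsub>K\<^esub> f (x, y)"
    if "x \<in> carrier G" "y \<in> carrier G" "z \<in> carrier G" for x y z
    using that Z2_cocycle[OF f that] C2_closed[OF fC] by (simp flip: K.inv_mult)
  with fC show "inv\<^bsub>C2\<^esub> f \<in> Z2" by (simp add: Z2_iff inv_C2)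
  fix g assume g: "g \<in> Z2"
  have gC: "g \<in> carrier C2" using g by (rule Z2_carrier)
  have "f (y, z) \<otimes>\<^bsub>K\<^esub> g (y, z) \<otimes>\<^bsub>K\<^esub> (f (x, y \<otimes> z) \<otimes>\<^bsub>K\<^esub> g (x, y \<otimes> z))
      = f (x \<otimes> y, z) \<otimes>\<^bsub>K\<^esub> g (x \<otimes> y, z) \<otimes>\<^bsub>K\<^esub> (f (x, y) \<otimes>\<^bsub>K\<^esub> g (x, y))" (is "?l = ?r")
    if xyz: "x \<in> carrier G" "y \<in> carrier G" "z \<in> carrier G" for x y z
  proof -
    have "?l = (f (y, z) \<otimes>\<^bsub>K\<^esub> f (x, y \<otimes> z)) \<otimes>\<^bsub>K\<^esub> (g (y, z) \<otimes>\<^bsub>K\<^esub> g (x, y \<otimes> z))"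
      using xyz C2_closed[OF fC] C2_closed[OF gC] by (simp add: K.m_ac)
    also have "\<dots> = ?r"
      unfolding Z2_cocycle[OF f xyz] Z2_cocycle[OF g xyz]
      using xyz C2_closed[OF fC] C2_closed[OF gC] by (simp add: K.m_ac)
    finally show ?thesis .
  qed
  with fC gC show "f \<otimes>\<^bsub>C2\<^esub> g \<in> Z2" by (simp add: Z2_iff mult_C2)
qed

lemma coboundary_apply:
  "\<lbrakk>x \<in> carrier G; y \<in> carrier G\<rbrakk>
    \<Longrightarrow> coboundary G K h (x, y) = h y \<otimes>\<^bsub>K\<^esub> inv\<^bsub>K\<^esub> h (x \<otimes> y) \<otimes>\<^bsub>K\<^esub> h x"
  by (simp add: coboundary_def)

lemma coboundary_closed:
  "h \<in> carrier G \<rightarrow> carrier K \<Longrightarrow> coboundary G K h \<in> carrier C2"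
  by (auto simp: carrier_C2 coboundary_def Pi_iff)

lemma coboundary_Z2:
  assumes h: "h \<in> carrier G \<rightarrow> carrier K"
  shows "coboundary G K h \<in> Z2"
proof -
  have "h z \<otimes>\<^bsub>K\<^esub> inv\<^bsub>K\<^esub> h (y \<otimes> z) \<otimes>\<^bsub>K\<^esub> h y
        \<otimes>\<^bsub>K\<^esub> (h (y \<otimes> z) \<otimes>\<^bsub>K\<^esub> inv\<^bsub>K\<^esub> h (x \<otimes> (y \<otimes> z)) \<otimes>\<^bsub>K\<^esub> h x)
      = h z \<otimes>\<^bsub>K\<^esub> inv\<^bsub>K\<^esub> h (x \<otimes> y \<otimes> z) \<otimes>\<^bsub>K\<^esub> h (x \<otimes> y)
        \<otimes>\<^bsub>K\<^esub> (h y \<otimes>\<^bsub>K\<^esub> inv\<^bsub>K\<^esub> h (x \<otimes> y) \<otimes>\<^bsub>K\<^esub> h x)"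
    if xyz: "x \<in> carrier G" "y \<in> carrier G" "z \<in> carrier G" for x y z
  proof -
    \<comment> \<open>The factor \<open>b\<close> stands for h(yz) in the first rule and for h(xy)
      in the second. Once it cancels, both sides of the cocycle identity have the same form h(z)
      h(y) h(xyz)^-1 h(x).\<close>
    have cancel: "a \<otimes>\<^bsub>K\<^esub> inv\<^bsub>K\<^esub> b \<otimes>\<^bsub>K\<^esub> c \<otimes>\<^bsub>K\<^esub> (b \<otimes>\<^bsub>K\<^esub> d \<otimes>\<^bsub>K\<^esub> e) = a \<otimes>\<^bsub>K\<^esub> c \<otimes>\<^bsub>K\<^esub> d \<otimes>\<^bsub>K\<^esub> e"
      "a \<otimes>\<^bsub>K\<^esub> d \<otimes>\<^bsub>K\<^esub> b \<otimes>\<^bsub>K\<^esub> (c \<otimes>\<^bsub>K\<^esub> inv\<^bsub>K\<^esub> b \<otimes>\<^bsub>K\<^esub> e) = a \<otimes>\<^bsub>K\<^esub> c \<otimes>\<^bsub>K\<^esub> d \<otimes>\<^bsub>K\<^esub> e"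
      if "a \<in> carrier K" "b \<in> carrier K" "c \<in> carrier K" "d \<in> carrier K" "e \<in> carrier K"
      for a b c d e
    proof -
      have "a \<otimes>\<^bsub>K\<^esub> inv\<^bsub>K\<^esub> b \<otimes>\<^bsub>K\<^esub> c \<otimes>\<^bsub>K\<^esub> (b \<otimes>\<^bsub>K\<^esub> d \<otimes>\<^bsub>K\<^esub> e)
          = (b \<otimes>\<^bsub>K\<^esub> inv\<^bsub>K\<^esub> b) \<otimes>\<^bsub>K\<^esub> (a \<otimes>\<^bsub>K\<^esub> c \<otimes>\<^bsub>K\<^esub> d \<otimes>\<^bsub>K\<^esub> e)"
        "a \<otimes>\<^bsub>K\<^esub> d \<otimes>\<^bsub>K\<^esub> b \<otimes>\<^bsub>K\<^esub> (c \<otimes>\<^bsub>K\<^esub> inv\<^bsub>K\<^esub> b \<otimes>\<^bsub>K\<^esub> e)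
          = (b \<otimes>\<^bsub>K\<^esub> inv\<^bsub>K\<^esub> b) \<otimes>\<^bsub>K\<^esub> (a \<otimes>\<^bsub>K\<^esub> c \<otimes>\<^bsub>K\<^esub> d \<otimes>\<^bsub>K\<^esub> e)"
        by (simp_all only: that K.m_ac K.m_closed K.inv_closed)
      with that show "a \<otimes>\<^bsub>K\<^esub> inv\<^bsub>K\<^esub> b \<otimes>\<^bsub>K\<^esub> c \<otimes>\<^bsub>K\<^esub> (b \<otimes>\<^bsub>K\<^esub> d \<otimes>\<^bsub>K\<^esub> e) = a \<otimes>\<^bsub>K\<^esub> c \<otimes>\<^bsub>K\<^esub> d \<otimes>\<^bsub>K\<^esub> e"
        "a \<otimes>\<^bsub>K\<^esub> d \<otimes>\<^bsub>K\<^esub> b \<otimes>\<^bsub>K\<^esub> (c \<otimes>\<^bsub>K\<^esub> inv\<^bsub>K\<^esub> b \<otimes>\<^bsub>K\<^esub> e) = a \<otimes>\<^bsub>K\<^esub> c \<otimes>\<^bsub>K\<^esub> d \<otimes>\<^bsub>K\<^esub> e"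
        by simp_all
    qed
    show ?thesis
      using h xyz by (simp add: cancel Pi_iff G.m_assoc)
  qed
  with h show ?thesis
    by (simp add: Z2_iff coboundary_closed coboundary_apply)
qed

lemma subgroup_B2: "subgroup B2 C2"
proof (rule C2.subgroupI)
  show "B2 \<subseteq> carrier C2" by (auto simp: group_B2_def coboundary_closed)
  have "coboundary G K (\<lambda>_. \<one>\<^bsub>K\<^esub>) \<in> B2" by (auto simp: group_B2_def)
  then show "B2 \<noteq> {}" by blast
  fix f assume "f \<in> B2"
  then obtain h where h: "h \<in> carrier G \<rightarrow> carrier K" and f: "f = coboundary G K h"
    by (auto simp: group_B2_def)
  have h': "(\<lambda>x. inv\<^bsub>K\<^esub> h x) \<in> carrier G \<rightarrow> carrier K" using h by auto
  have "inv\<^bsub>C2\<^esub> f = coboundary G K (\<lambda>x. inv\<^bsub>K\<^esub> h x)"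
    using h h' unfolding f
    by (intro C2_eqI)
      (auto simp: coboundary_closed coboundary_apply inv_C2 K.inv_mult Pi_iff)
  with h' show "inv\<^bsub>C2\<^esub> f \<in> B2" by (auto simp: group_B2_def)
  fix g assume "g \<in> B2"
  then obtain k where k: "k \<in> carrier G \<rightarrow> carrier K" and g: "g = coboundary G K k"
    by (auto simp: group_B2_def)
  have hk: "(\<lambda>x. h x \<otimes>\<^bsub>K\<^esub> k x) \<in> carrier G \<rightarrow> carrier K" using h k by auto
  have "f \<otimes>\<^bsub>C2\<^esub> g = coboundary G K (\<lambda>x. h x \<otimes>\<^bsub>K\<^esub> k x)"
    using h k hk unfolding f g
    by (intro C2_eqI)
      (auto simp: coboundary_closed coboundary_apply mult_C2 K.inv_mult Pi_iff K.m_ac)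
  with hk show "f \<otimes>\<^bsub>C2\<^esub> g \<in> B2" by (auto simp: group_B2_def)
qed

lemma comm_group_Z2: "comm_group (C2\<lparr>carrier := Z2\<rparr>)"
  by (rule group.group_comm_groupI[OF C2.subgroup_imp_group[OF subgroup_Z2]])
    (auto simp: Z2_carrier C2.m_comm)

sublocale Z2: comm_group "C2\<lparr>carrier := Z2\<rparr>" by (rule comm_group_Z2)

lemma normal_B2: "B2 \<lhd> C2\<lparr>carrier := Z2\<rparr>"
proof (rule Z2.subgroup_imp_normal)
  show "subgroup B2 (C2\<lparr>carrier := Z2\<rparr>)"
    by (rule C2.subgroup_incl[OF subgroup_B2 subgroup_Z2])
      (auto simp: group_B2_def coboundary_Z2)
qed

section \<open>Normalized cocycles and factor sets of trivial skew braces\<close>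

lemma Z2_at_one:
  assumes f: "f \<in> Z2" and x: "x \<in> carrier G"
  shows "f (\<one>, x) = f (\<one>, \<one>)" and "f (x, \<one>) = f (\<one>, \<one>)"
proof -
  note cl = C2_closed[OF Z2_carrier[OF f]]
  \<comment> \<open>The cocycle identity at (1, 1, x), and below at (x, 1, 1), has a common factor
    on both sides. Cancelling it shows that normalization can be tested at (1, 1) alone.\<close>
  show "f (\<one>, x) = f (\<one>, \<one>)"
    using Z2_cocycle[OF f G.one_closed G.one_closed x] x cl by simp
  show "f (x, \<one>) = f (\<one>, \<one>)"
    using Z2_cocycle[OF f x G.one_closed G.one_closed] x cl by simp
qed

text \<open>The compatibility condition of factor sets for the pair (f, f). It combines the cocycle
  identities at (x, y, z), (x^-1, x, z) and (xy, x^-1, xz). Normalization removes the factor f(1, z)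
  from the second.\<close>

lemma Z2_brace_condition:
  assumes f: "f \<in> Z2" and f1: "f (\<one>, \<one>) = \<one>\<^bsub>K\<^esub>"
    and x: "x \<in> carrier G" and y: "y \<in> carrier G" and z: "z \<in> carrier G"
  shows "f (y, z) \<otimes>\<^bsub>K\<^esub> f (x, y \<otimes> z) \<otimes>\<^bsub>K\<^esub> f (inv x, x)
    = f (x, z) \<otimes>\<^bsub>K\<^esub> f (x \<otimes> y, inv x) \<otimes>\<^bsub>K\<^esub> f (x \<otimes> y \<otimes> inv x, x \<otimes> z) \<otimes>\<^bsub>K\<^esub> f (x, y)"
proof -
  note [simp] = C2_closed[OF Z2_carrier[OF f]] x y z
  have ix: "inv x \<otimes> (x \<otimes> z) = z" by (simp flip: G.m_assoc)
  have 1: "f (y, z) \<otimes>\<^bsub>K\<^esub> f (x, y \<otimes> z) = f (x \<otimes> y, z) \<otimes>\<^bsub>K\<^esub> f (x, y)"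
    by (rule Z2_cocycle[OF f x y z])
  have 2: "f (inv x, x) = f (x, z) \<otimes>\<^bsub>K\<^esub> f (inv x, x \<otimes> z)"
    using Z2_cocycle[OF f _ x z, of "inv x"] Z2_at_one[OF f z] f1 by simp
  have 3: "f (inv x, x \<otimes> z) \<otimes>\<^bsub>K\<^esub> f (x \<otimes> y, z)
      = f (x \<otimes> y \<otimes> inv x, x \<otimes> z) \<otimes>\<^bsub>K\<^esub> f (x \<otimes> y, inv x)"
    using Z2_cocycle[OF f, of "x \<otimes> y" "inv x" "x \<otimes> z"] by (simp add: ix)
  have "f (y, z) \<otimes>\<^bsub>K\<^esub> f (x, y \<otimes> z) \<otimes>\<^bsub>K\<^esub> f (inv x, x)
      = f (x, z) \<otimes>\<^bsub>K\<^esub> (f (inv x, x \<otimes> z) \<otimes>\<^bsub>K\<^esub> f (x \<otimes> y, z)) \<otimes>\<^bsub>K\<^esub> f (x, y)"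
    unfolding 1 2 by (simp add: K.m_ac)
  also have "\<dots> = f (x, z) \<otimes>\<^bsub>K\<^esub> f (x \<otimes> y, inv x) \<otimes>\<^bsub>K\<^esub> f (x \<otimes> y \<otimes> inv x, x \<otimes> z) \<otimes>\<^bsub>K\<^esub> f (x, y)"
    unfolding 3 by (simp add: K.m_ac)
  finally show ?thesis .
qed

text \<open>Both cocycle conditions become the one for \<open>G\<close>, and normalization on both
  axes shrinks to the value at (1, 1) by \<open>Z2_at_one\<close>. Compatibility is the only link
  left between \<alpha> and \<mu>.\<close>

lemma factor_set_trivial_iff:
  "factor_set (trivial_skew_brace G) K \<alpha> \<mu> \<longleftrightarrow>
    \<alpha> \<in> Z2 \<and> \<mu> \<in> Z2 \<and> \<alpha> (\<one>, \<one>) = \<one>\<^bsub>K\<^esub> \<and> \<mu> (\<one>, \<one>) = \<one>\<^bsub>K\<^esub> \<and>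
    (\<forall>x\<in>carrier G. \<forall>y\<in>carrier G. \<forall>z\<in>carrier G.
      \<alpha> (y, z) \<otimes>\<^bsub>K\<^esub> \<mu> (x, y \<otimes> z) \<otimes>\<^bsub>K\<^esub> \<alpha> (inv x, x)
      = \<mu> (x, z) \<otimes>\<^bsub>K\<^esub> \<alpha> (x \<otimes> y, inv x) \<otimes>\<^bsub>K\<^esub> \<alpha> (x \<otimes> y \<otimes> inv x, x \<otimes> z) \<otimes>\<^bsub>K\<^esub> \<mu> (x, y))"
proof -
  have normalized: "(\<forall>x\<in>carrier G. f (\<one>, x) = \<one>\<^bsub>K\<^esub> \<and> f (x, \<one>) = \<one>\<^bsub>K\<^esub>) \<longleftrightarrow> f (\<one>, \<one>) = \<one>\<^bsub>K\<^esub>"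
    if "f \<in> Z2" for f
    using Z2_at_one[OF that] by (metis G.one_closed)
  have "cocycle_condition (add_monoid (trivial_skew_brace G)) K f = cocycle_condition G K f"
    "cocycle_condition (trivial_skew_brace G) K f = cocycle_condition G K f" for f
    by (simp_all add: cocycle_condition_def)
  then show ?thesis
    using normalized[of \<alpha>] normalized[of \<mu>]
    by (simp add: factor_set_def group_Z2_def a_minus_def) argo
qed

section \<open>Factor sets over a perfect group\<close>

lemma factor_set_eq:
  assumes perfect: "perfect_group G" and fs: "factor_set (trivial_skew_brace G) K \<alpha> \<mu>"
  shows "\<mu> = \<alpha>"
proof -
  from fs have \<alpha>: "\<alpha> \<in> Z2" and \<mu>: "\<mu> \<in> Z2" and \<alpha>1: "\<alpha> (\<one>, \<one>) = \<one>\<^bsub>K\<^esub>"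
    by (auto simp: factor_set_trivial_iff)
  define \<beta> where "\<beta> = \<mu> \<otimes>\<^bsub>C2\<^esub> inv\<^bsub>C2\<^esub> \<alpha>"
  have \<beta>: "\<beta> \<in> Z2"
    unfolding \<beta>_def
    by (intro subgroup.m_closed[OF subgroup_Z2] subgroup.m_inv_closed[OF subgroup_Z2] \<alpha> \<mu>)
  note [simp] = C2_closed[OF Z2_carrier[OF \<alpha>]] C2_closed[OF Z2_carrier[OF \<beta>]]
  have "\<mu> = \<beta> \<otimes>\<^bsub>C2\<^esub> \<alpha>"
    using \<alpha> \<mu> by (simp add: \<beta>_def C2.m_assoc Z2_carrier)
  then have \<mu>_eq: "\<mu> (x, y) = \<beta> (x, y) \<otimes>\<^bsub>K\<^esub> \<alpha> (x, y)"
    if "x \<in> carrier G" "y \<in> carrier G" for x y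
    using that by (simp add: mult_C2)
  have right: "\<beta> (x, y \<otimes> z) = \<beta> (x, y) \<otimes>\<^bsub>K\<^esub> \<beta> (x, z)"
    if xyz: "x \<in> carrier G" "y \<in> carrier G" "z \<in> carrier G" for x y z
  proof -
    note [simp] = xyz
    \<comment> \<open>\<open>?a\<close> is the left side of the compatibility condition for
      (\<alpha>, \<alpha>). Substituting \<mu> = \<beta> \<alpha> into the condition for (\<alpha>,
      \<mu>) multiplies that identity by \<beta>(x, yz) on the left and by \<beta>(x, y) \<beta>(x,
      z) on the right, so \<open>?a\<close> cancels.\<close>
    let ?a = "\<alpha> (y, z) \<otimes>\<^bsub>K\<^esub> \<alpha> (x, y \<otimes> z) \<otimes>\<^bsub>K\<^esub> \<alpha> (inv x, x)"
    have "\<beta> (x, y \<otimes> z) \<otimes>\<^bsub>K\<^esub> ?a = \<alpha> (y, z) \<otimes>\<^bsub>K\<^esub> \<mu> (x, y \<otimes> z) \<otimes>\<^bsub>K\<^esub> \<alpha> (inv x, x)"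
      by (simp add: \<mu>_eq K.m_ac)
    also have "\<dots> = \<mu> (x, z) \<otimes>\<^bsub>K\<^esub> \<alpha> (x \<otimes> y, inv x) \<otimes>\<^bsub>K\<^esub> \<alpha> (x \<otimes> y \<otimes> inv x, x \<otimes> z) \<otimes>\<^bsub>K\<^esub> \<mu> (x, y)"
      using fs xyz by (simp add: factor_set_trivial_iff)
    also have "\<dots> = \<beta> (x, y) \<otimes>\<^bsub>K\<^esub> \<beta> (x, z) \<otimes>\<^bsub>K\<^esub> ?a"
      unfolding Z2_brace_condition[OF \<alpha> \<alpha>1 xyz] by (simp add: \<mu>_eq K.m_ac)
    finally show ?thesis by simp
  qed
  have left: "\<beta> (x \<otimes> y, z) = \<beta> (x, z) \<otimes>\<^bsub>K\<^esub> \<beta> (y, z)"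
    if xyz: "x \<in> carrier G" "y \<in> carrier G" "z \<in> carrier G" for x y z
  proof -
    \<comment> \<open>Expanding \<beta>(x, yz) by \<open>right\<close> in the cocycle identity of
      \<beta> leaves \<beta>(x, y) as a common factor.\<close>
    have "\<beta> (x \<otimes> y, z) \<otimes>\<^bsub>K\<^esub> \<beta> (x, y) = \<beta> (x, z) \<otimes>\<^bsub>K\<^esub> \<beta> (y, z) \<otimes>\<^bsub>K\<^esub> \<beta> (x, y)"
      using Z2_cocycle[OF \<beta> xyz] xyz by (simp add: right K.m_ac)
    then show ?thesis using xyz by simp
  qed
  \<comment> \<open>For fixed z, \<open>left\<close> makes \<beta>(_, z) a homomorphism from the
    perfect group \<open>G\<close> to the abelian group \<open>K\<close>.\<close>
  have "\<beta> (x, z) = \<one>\<^bsub>K\<^esub>" if "x \<in> carrier G" "z \<in> carrier G" for x z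
    using that left
    by (intro perfect_hom_trivial[OF perfect K.comm_group_axioms, of "\<lambda>x. \<beta> (x, z)"])
      (auto simp: hom_def)
  with \<alpha> \<mu> show ?thesis
    by (intro C2_eqI) (auto simp: Z2_carrier \<mu>_eq)
qed

text \<open>\<open>factor_set_eq\<close> forces the two components to agree, and
  \<open>Z2_brace_condition\<close> shows that every normalized cocycle used twice is a factor
  set.\<close>

lemma brace_Z2_perfect:
  assumes "perfect_group G"
  shows "brace_Z2 (trivial_skew_brace G) K = {(f, f) | f. f \<in> Z2 \<and> f (\<one>, \<one>) = \<one>\<^bsub>K\<^esub>}"
proof -
  have "factor_set (trivial_skew_brace G) K \<alpha> \<mu> \<longleftrightarrow> \<mu> = \<alpha> \<and> \<alpha> \<in> Z2 \<and> \<alpha> (\<one>, \<one>) = \<one>\<^bsub>K\<^esub>" for \<alpha> \<mu>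
    using factor_set_eq[OF assms] Z2_brace_condition by (auto simp: factor_set_trivial_iff)
  then show ?thesis by (auto simp: brace_Z2_def)
qed

section \<open>Comparison of the two second cohomology groups\<close>

lemma coboundary_at_one:
  "h \<in> carrier G \<rightarrow> carrier K \<Longrightarrow> coboundary G K h (\<one>, \<one>) = h \<one>"
  by (auto simp: coboundary_apply Pi_iff)

text \<open>The coboundary of h takes the value h(1) at (1, 1), so the requirement h(0) = 1 can be
  read off from the coboundary itself.\<close>

lemma brace_B2_trivial:
  "brace_B2 (trivial_skew_brace G) K = {(f, f) | f. f \<in> B2 \<and> f (\<one>, \<one>) = \<one>\<^bsub>K\<^esub>}"
proof -
  have "coboundary (add_monoid (trivial_skew_brace G)) K h = coboundary G K h"
    "coboundary (trivial_skew_brace G) K h = coboundary G K h" for h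
    by (simp_all add: coboundary_def)
  then show ?thesis
    using coboundary_at_one by (auto simp: brace_B2_def group_B2_def)
qed

lemma normalized_representative:
  assumes f: "f \<in> Z2"
  obtains b where "b \<in> B2" "(b \<otimes>\<^bsub>C2\<^esub> f) (\<one>, \<one>) = \<one>\<^bsub>K\<^esub>"
proof
  have c: "f (\<one>, \<one>) \<in> carrier K" by (rule C2_closed[OF Z2_carrier[OF f]]) simp_all
  \<comment> \<open>The coboundary of a constant map is constant with the same value, so the
    constant f(1, 1)^-1 corrects f at (1, 1).\<close>
  then show "coboundary G K (\<lambda>_. inv\<^bsub>K\<^esub> f (\<one>, \<one>)) \<in> B2" by (auto simp: group_B2_def)
  from c show "(coboundary G K (\<lambda>_. inv\<^bsub>K\<^esub> f (\<one>, \<one>)) \<otimes>\<^bsub>C2\<^esub> f) (\<one>, \<one>) = \<one>\<^bsub>K\<^esub>"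
    by (simp add: mult_C2 coboundary_at_one)
qed

text \<open>The first isomorphism theorem for the map sending (f, f) to the class of f: it is onto
  by normalized representatives, and its kernel consists of the pairs of normalized
  coboundaries.\<close>

theorem group_H2_iso_brace_H2:
  assumes perfect: "perfect_group G"
  shows "group_H2 G K \<cong> brace_H2 (trivial_skew_brace G) K"
proof -
  define Zb where
    "Zb = (C2 \<times>\<times> C2)\<lparr>carrier := brace_Z2 (trivial_skew_brace G) K\<rparr>"
  interpret CC: group "C2 \<times>\<times> C2"
    by (rule DirProd_group[OF C2.is_group C2.is_group])
  have "subgroup (brace_Z2 (trivial_skew_brace G) K) (C2 \<times>\<times> C2)"
  proof (rule CC.subgroupI, unfold brace_Z2_perfect[OF perfect])
    let ?Z = "{(f, f) | f. f \<in> Z2 \<and> f (\<one>, \<one>) = \<one>\<^bsub>K\<^esub>}"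
    show "?Z \<subseteq> carrier (C2 \<times>\<times> C2)" by (auto simp: Z2_carrier)
    have "(\<one>\<^bsub>C2\<^esub>, \<one>\<^bsub>C2\<^esub>) \<in> ?Z"
      by (simp add: subgroup.one_closed[OF subgroup_Z2] one_C2)
    then show "?Z \<noteq> {}" by blast
    show "inv\<^bsub>C2 \<times>\<times> C2\<^esub> a \<in> ?Z" if "a \<in> ?Z" for a
      using that
      by (auto simp: inv_DirProd[OF C2.is_group C2.is_group] Z2_carrier inv_C2
          subgroup.m_inv_closed[OF subgroup_Z2])
    show "a \<otimes>\<^bsub>C2 \<times>\<times> C2\<^esub> b \<in> ?Z" if "a \<in> ?Z" "b \<in> ?Z" for a b
      using that by (auto simp: mult_C2 subgroup.m_closed[OF subgroup_Z2])
  qed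
  then interpret Zb: group Zb unfolding Zb_def by (rule CC.subgroup_imp_group)
  interpret B2: normal B2 "C2\<lparr>carrier := Z2\<rparr>" by (rule normal_B2)
  define coset where "coset = (\<lambda>f. B2 #>\<^bsub>C2\<lparr>carrier := Z2\<rparr>\<^esub> f)"
  have H2: "group_H2 G K = C2\<lparr>carrier := Z2\<rparr> Mod B2" by (simp add: group_H2_def)
  have coset_hom: "coset \<in> hom (C2\<lparr>carrier := Z2\<rparr>) (group_H2 G K)"
    unfolding coset_def H2 by (rule B2.r_coset_hom_Mod)
  have carrier_H2: "carrier (group_H2 G K) = coset ` Z2"
    by (auto simp: H2 FactGroup_def RCOSETS_def coset_def)
  interpret \<phi>: group_hom Zb "group_H2 G K" "coset \<circ> fst"
  proof (unfold group_hom_def group_hom_axioms_def, intro conjI)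
    show "group Zb" by (rule Zb.is_group)
    show "group (group_H2 G K)" unfolding H2 by (rule B2.factorgroup_is_group)
    show "coset \<circ> fst \<in> hom Zb (group_H2 G K)"
      using coset_hom by (auto simp: Zb_def brace_Z2_perfect[OF perfect] hom_def)
  qed
  have "(coset \<circ> fst) ` carrier Zb = carrier (group_H2 G K)"
  proof
    show "(coset \<circ> fst) ` carrier Zb \<subseteq> carrier (group_H2 G K)"
      by (auto simp: carrier_H2 Zb_def brace_Z2_perfect[OF perfect])
    show "carrier (group_H2 G K) \<subseteq> (coset \<circ> fst) ` carrier Zb"
    proof
      fix c assume "c \<in> carrier (group_H2 G K)"
      then obtain f where f: "f \<in> Z2" and c: "c = coset f" by (auto simp: carrier_H2)
      \<comment> \<open>Multiplying by the coboundary \<open>b\<close> stays in the coset of f, so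
        the pair with both entries equal to the normalized product is a preimage of
        \<open>c\<close>.\<close>
      obtain b where b: "b \<in> B2" and n: "(b \<otimes>\<^bsub>C2\<^esub> f) (\<one>, \<one>) = \<one>\<^bsub>K\<^esub>"
        by (rule normalized_representative[OF f])
      have "b \<in> Z2" using b B2.subset by auto
      with f have z: "b \<otimes>\<^bsub>C2\<^esub> f \<in> Z2" by (rule subgroup.m_closed[OF subgroup_Z2, rotated -1])
      have "b \<otimes>\<^bsub>C2\<^esub> f \<in> coset f"
        using b by (auto simp: coset_def r_coset_def)
      then have "coset f = coset (b \<otimes>\<^bsub>C2\<^esub> f)"
        unfolding coset_def using f
        by (intro Z2.repr_independence) (auto intro: B2.subgroup_axioms)
      with c z n show "c \<in> (coset \<circ> fst) ` carrier Zb"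
        by (auto simp: Zb_def brace_Z2_perfect[OF perfect] image_iff)
    qed
  qed
  from group.iso_sym[OF normal.factorgroup_is_group[OF \<phi>.normal_kernel] \<phi>.FactGroup_iso[OF this]]
  have "group_H2 G K \<cong> Zb Mod kernel Zb (group_H2 G K) (coset \<circ> fst)" .
  moreover have "kernel Zb (group_H2 G K) (coset \<circ> fst) = brace_B2 (trivial_skew_brace G) K"
  proof -
    have one: "\<one>\<^bsub>group_H2 G K\<^esub> = B2" by (simp add: H2)
    have "coset f = \<one>\<^bsub>group_H2 G K\<^esub> \<longleftrightarrow> f \<in> B2" if "f \<in> Z2" for f
    proof
      have f: "f \<in> carrier (C2\<lparr>carrier := Z2\<rparr>)" using that by simp
      show "f \<in> B2" if "coset f = \<one>\<^bsub>group_H2 G K\<^esub>"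
        by (rule Z2.coset_join1[OF that[unfolded coset_def one] f B2.subgroup_axioms])
      show "coset f = \<one>\<^bsub>group_H2 G K\<^esub>" if "f \<in> B2"
        unfolding coset_def one by (rule Z2.coset_join2[OF f B2.subgroup_axioms that])
    qed
    moreover have "B2 \<subseteq> Z2" using B2.subset by simp
    ultimately have B2_iff: "f \<in> B2 \<longleftrightarrow> f \<in> Z2 \<and> coset f = \<one>\<^bsub>group_H2 G K\<^esub>" for f
      by blast
    \<comment> \<open>After \<open>B2_iff\<close> is unfolded, a coboundary is a cocycle of trivial
      class. This identity, with predicate variables, moves the triviality of the class out as a
      filter on the pairs, which is the form of a kernel.\<close>
    have "{(f, f) | f. (P f \<and> R f) \<and> Q f} = {z \<in> {(f, f) | f. P f \<and> Q f}. R (fst z)}"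
      for P Q R :: "('a \<times> 'a \<Rightarrow> 'c) \<Rightarrow> bool"
      by auto
    then have "{(f, f) | f. f \<in> B2 \<and> f (\<one>, \<one>) = \<one>\<^bsub>K\<^esub>}
        = {z \<in> {(f, f) | f. f \<in> Z2 \<and> f (\<one>, \<one>) = \<one>\<^bsub>K\<^esub>}. coset (fst z) = \<one>\<^bsub>group_H2 G K\<^esub>}"
      unfolding B2_iff .
    then show ?thesis
      by (simp add: kernel_def Zb_def brace_Z2_perfect[OF perfect] brace_B2_trivial)
  qed
  ultimately show ?thesis by (simp add: brace_H2_def Zb_def)
qed

end

section \<open>Schur covers of perfect groups as skew brace Schur covers\<close>

theorem proposition3p15:
  fixes G :: "('g, 'n) monoid_scheme" and H :: "('h, 'm) monoid_scheme"
  assumes "group G" and "finite (carrier G)" and "perfect_group G"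
    and "group H" and "group_schur_cover H G"
  shows "brace_schur_cover (trivial_skew_brace H) (trivial_skew_brace G)"
proof -
  interpret H: group H by fact
  interpret cohomology G units_complex
    using assms(1) comm_group_units_complex by (rule cohomology.intro)
  obtain K :: "'h monoid" and i p where ext: "central_extension K i H p G"
    and K: "i ` carrier K \<subseteq> derived H (carrier H)" "K \<cong> schur_multiplier G"
    using assms(5) unfolding group_schur_cover_def by blast
  \<comment> \<open>Perfectness of \<open>G\<close> enters here. The data \<open>K\<close>,
    \<open>i\<close>, \<open>p\<close> of the group extension are kept, and the isomorphism from
    \<open>K\<close> is composed with this one.\<close>
  have "schur_multiplier G \<cong> brace_schur_multiplier (trivial_skew_brace G)"
    unfolding schur_multiplier_def brace_schur_multiplier_def
    by (rule group_H2_iso_brace_H2[OF assms(3)])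
  with K(2) have "K \<cong> brace_schur_multiplier (trivial_skew_brace G)"
    by (rule iso_trans)
  moreover have "i ` carrier K \<subseteq> brace_commutator (trivial_skew_brace H)"
    using K(1) H.derived_subset_brace_commutator by blast
  ultimately show ?thesis
    unfolding brace_schur_cover_def trivial_skew_brace_simps
    using H.central_extension_trivial_skew_brace[OF ext] skew_brace_trivial[OF assms(1)] assms(2)
    by blast
qed

end
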